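(* Let $\mathcal{A}=(Q,\Sigma,q_I,\Delta,F)$ be a probabilistic automaton with $\Sigma\ne\emptyset$, and let $\theta_{\mathcal{A}}:=\mu F.\big(\lambda X.\,X\lor\bigvee_{c\in\Sigma}F\,(f_c\,X)\big)$, a PHFL formula of type $\mathbf{Prop}\to\mathbf{Prop}$. Then $\mathrm{val}(\mathcal{A})=[\![\theta_{\mathcal{A}}\,p_F]\!]_{M_{\mathcal{A}}}(q_I)$. Consequently $M_{\mathcal{A}}\models[\theta_{\mathcal{A}}\,p_F]_{\ge1}$ if and only if $\mathrm{val}(\mathcal{A})=1$.
   Context: A probabilistic automaton $\mathcal{A}=(Q,\Sigma,q_I,\Delta,F)$ has finite state set $Q$, finite alphabet $\Sigma$, initial state $q_I$, $\Delta:Q\times\Sigma\to D(Q)$ (probability distributions on $Q$), accepting set $F\subseteq Q$. For $w=w_1\cdots w_n$, $\mathcal{A}(w)=\sum_{q_0=q_I,\,q_1,\dots,q_{n-1}\in Q,\,q_n\in F}\prod_{i=1}^n\Delta(q_{i-1},w_i)(q_i)$, and $\mathrm{val}(\mathcal{A})=\sup_{w\in\Sigma^*}\mathcal{A}(w)$. The Markov chain $M_{\mathcal{A}}=(S,P,L,s_{in})$: $S=Q\uplus(Q\times\Sigma)$, $P((q,c),q')=\Delta(q,c)(q')$, $P(q,(q,c))=1/|\Sigma|$, $P=0$ otherwise; $L(p_c)=\{(q,c)\mid q\in Q\}$ for $c\in\Sigma$, $L(p_F)=F$; $s_{in}=q_I$. $f_c:=\lambda X.\Diamond(p_c\land\bigcirc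 X)$. PHFL semantics on a Markov chain: type $\mathbf{Prop}$ is interpreted as $[0,1]^S$ (pointwise order), $\mathbf{Prop}\to\mathbf{Prop}$ as monotone functions (pointwise order); $[\![p]\!](s)=1$ iff $s\in L(p)$, else $0$; $\land,\lor$ (and finite $\bigvee$) are pointwise min/max; $[\![\Diamond\varphi]\!](s)=\max_{s':P(s,s')>0}[\![\varphi]\!](s')$; $[\![\bigcirc\varphi]\!](s)=\sum_{s'}P(s,s')[\![\varphi]\!](s')$; $\mu F.\psi$ is the least fixpoint of $v\mapsto[\![\psi]\!][F\mapsto v]$; $[\![[\varphi]_{\ge1}]\!](s)=1$ iff $[\![\varphi]\!](s)\ge1$, else $0$. $M\models\varphi$ iff $[\![\varphi]\!](s_{in})=1$. *)

theory Defs
  imports "HOL-Probability.Probability_Mass_Function" "HOL-Library.FSet"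
begin

section \<open>Probabilistic automata\<close>

text \<open>The finite state set and the finite, nonempty alphabet are the type variables
  \<open>'q\<close> and \<open>'c\<close>, instantiated by arbitrary types of class \<open>finite\<close>.\<close>

record ('q, 'c) prob_automaton =
  initial :: 'q
  delta :: "'q \<Rightarrow> 'c \<Rightarrow> 'q pmf"
  final :: "'q set"

text \<open>A run on \<open>w\<close> is the list \<open>[q\<^sub>0, \<dots>, q\<^sub>n]\<close> of all \<open>n + 1\<close> visited states, where
  \<open>n = length w\<close>. For \<open>w = []\<close> the initial state is also the last one, so the acceptance
  probability of the empty word is \<open>1\<close> or \<open>0\<close> according to whether the initial state is
  final.\<close>

definition accepting_runs :: "('q, 'c) prob_automaton \<Rightarrow> 'c list \<Rightarrow> 'q list set" where
  "accepting_runs A w =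
     {r. length r = Suc (length w) \<and> r ! 0 = initial A \<and> r ! length w \<in> final A}"

definition acc_prob :: "('q::finite, 'c) prob_automaton \<Rightarrow> 'c list \<Rightarrow> real" where
  "acc_prob A w =
     (\<Sum>r\<in>accepting_runs A w. \<Prod>i<length w. pmf (delta A (r ! i) (w ! i)) (r ! Suc i))"

definition val :: "('q::finite, 'c::finite) prob_automaton \<Rightarrow> real" where
  "val A = (SUP w. acc_prob A w)"


section \<open>The unit interval\<close>

typedef unit_interval = "{0..1::real}"
  by (rule exI[of _ 0]) simp

setup_lifting type_definition_unit_interval

instantiation unit_interval :: "{linorder, zero, one}"
begin

lift_definition zero_unit_interval :: unit_interval is 0 by simp
lift_definition one_unit_interval :: unit_interval is 1 by simp
lift_definition less_eq_unit_interval :: "unit_interval \<Rightarrow> unit_interval \<Rightarrow> bool"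
  is "(\<le>)" .
lift_definition less_unit_interval :: "unit_interval \<Rightarrow> unit_interval \<Rightarrow> bool"
  is "(<)" .

instance
  by standard (transfer; force)+

end

lift_definition expect :: "'s::finite pmf \<Rightarrow> ('s \<Rightarrow> unit_interval) \<Rightarrow> unit_interval"
  is "\<lambda>p v. \<Sum>s\<in>UNIV. pmf p s * v s"
proof -
  fix p :: "'s pmf" and v :: "'s \<Rightarrow> real"
  assume v: "\<And>s. v s \<in> {0..1}"
  have "(\<Sum>s\<in>UNIV. pmf p s * v s) \<le> (\<Sum>s\<in>UNIV. pmf p s)"
    using v by (intro sum_mono) (simp add: mult_left_le)
  also have "\<dots> = 1"
    by (simp add: sum_pmf_eq_1)
  finally show "(\<Sum>s\<in>UNIV. pmf p s * v s) \<in> {0..1}"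
    using v by (auto intro!: sum_nonneg)
qed


section \<open>Markov chains\<close>

record ('s, 'p) markov_chain =
  trans_prob :: "'s \<Rightarrow> 's pmf"
  labelling :: "'p \<Rightarrow> 's set"
  init_state :: 's


section \<open>PHFL\<close>

text \<open>Formulas over the types \<open>Prop\<close> and \<open>Prop \<rightarrow> Prop\<close>; the two
  types have disjoint name spaces of variables. \<open>FDisj\<close> is the finite disjunction over
  a set of formulas.\<close>

datatype 'p prop_formula =
    Atom 'p
  | PVar nat
  | And "'p prop_formula" "'p prop_formula"
  | Or "'p prop_formula" "'p prop_formula"
  | FDisj "'p prop_formula fset"
  | Diamond "'p prop_formula"
  | Next "'p prop_formula"
  | GeOne "'p prop_formula"
  | App "'p fun_formula" "'p prop_formula"
  | PMu nat "'p prop_formula"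
and 'p fun_formula =
    FVar nat
  | Lam nat "'p prop_formula"
  | FMu nat "'p fun_formula"

type_synonym 's prop_val = "'s \<Rightarrow> unit_interval"
type_synonym 's fun_val = "'s prop_val \<Rightarrow> 's prop_val"

text \<open>In \<open>sem_prop M \<phi> \<rho> \<eta>\<close> and \<open>sem_fun M \<psi> \<rho> \<eta>\<close>, \<open>\<rho>\<close> and \<open>\<eta>\<close> interpret
  the variables of type \<open>Prop\<close> and \<open>Prop \<rightarrow> Prop\<close>. The type \<open>Prop \<rightarrow> Prop\<close> denotes
  the monotone functions only: abstractions are monotone as soon as \<open>\<eta>\<close> takes monotone
  values, and the least fixpoint is taken among the monotone functions. The recursion
  through \<open>fset\<close> forces the use of \<open>fimage\<close>; see \<open>sem_prop_FDisj\<close> below.\<close>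

primrec
  sem_prop :: "('s::finite, 'p) markov_chain \<Rightarrow> 'p prop_formula \<Rightarrow>
    (nat \<Rightarrow> 's prop_val) \<Rightarrow> (nat \<Rightarrow> 's fun_val) \<Rightarrow> 's prop_val" and
  sem_fun :: "('s::finite, 'p) markov_chain \<Rightarrow> 'p fun_formula \<Rightarrow>
    (nat \<Rightarrow> 's prop_val) \<Rightarrow> (nat \<Rightarrow> 's fun_val) \<Rightarrow> 's fun_val" where
  "sem_prop M (Atom p) = (\<lambda>\<rho> \<eta> s. if s \<in> labelling M p then 1 else 0)"
| "sem_prop M (PVar x) = (\<lambda>\<rho> \<eta>. \<rho> x)"
| "sem_prop M (And \<phi> \<psi>) = (\<lambda>\<rho> \<eta> s. min (sem_prop M \<phi> \<rho> \<eta> s) (sem_prop M \<psi> \<rho> \<eta> s))"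
| "sem_prop M (Or \<phi> \<psi>) = (\<lambda>\<rho> \<eta> s. max (sem_prop M \<phi> \<rho> \<eta> s) (sem_prop M \<psi> \<rho> \<eta> s))"
| "sem_prop M (FDisj \<Phi>) =
     (\<lambda>\<rho> \<eta> s. Max (insert 0 ((\<lambda>v. v \<rho> \<eta> s) ` fset (fimage (sem_prop M) \<Phi>))))"
| "sem_prop M (Diamond \<phi>) =
     (\<lambda>\<rho> \<eta> s. Max {sem_prop M \<phi> \<rho> \<eta> s' | s'. pmf (trans_prob M s) s' > 0})"
| "sem_prop M (Next \<phi>) = (\<lambda>\<rho> \<eta> s. expect (trans_prob M s) (sem_prop M \<phi> \<rho> \<eta>))"
| "sem_prop M (GeOne \<phi>) = (\<lambda>\<rho> \<eta> s. if sem_prop M \<phi> \<rho> \<eta> s \<ge> 1 then 1 else 0)"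
| "sem_prop M (App \<psi> \<phi>) = (\<lambda>\<rho> \<eta>. sem_fun M \<psi> \<rho> \<eta> (sem_prop M \<phi> \<rho> \<eta>))"
| "sem_prop M (PMu x \<phi>) = (\<lambda>\<rho> \<eta>. LEAST v. sem_prop M \<phi> (\<rho>(x := v)) \<eta> = v)"
| "sem_fun M (FVar f) = (\<lambda>\<rho> \<eta>. \<eta> f)"
| "sem_fun M (Lam x \<phi>) = (\<lambda>\<rho> \<eta> v. sem_prop M \<phi> (\<rho>(x := v)) \<eta>)"
| "sem_fun M (FMu f \<psi>) =
     (\<lambda>\<rho> \<eta>. LEAST g. mono g \<and> sem_fun M \<psi> \<rho> (\<eta>(f := g)) = g)"

text \<open>The \<open>0\<close> only matters for the empty disjunction.\<close>

lemma sem_prop_FDisj: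
  "sem_prop M (FDisj \<Phi>) \<rho> \<eta> s =
     Max (insert 0 ((\<lambda>\<phi>. sem_prop M \<phi> \<rho> \<eta> s) ` fset \<Phi>))"
  by (simp add: image_image)

text \<open>Evaluation of closed formulas; the environment is irrelevant for these.\<close>

definition sem_closed :: "('s::finite, 'p) markov_chain \<Rightarrow> 'p prop_formula \<Rightarrow> 's prop_val" where
  "sem_closed M \<phi> = sem_prop M \<phi> (\<lambda>_ _. 0) (\<lambda>_ _ _. 0)"

definition models :: "('s::finite, 'p) markov_chain \<Rightarrow> 'p prop_formula \<Rightarrow> bool"
    (infix "\<Turnstile>" 50) where
  "M \<Turnstile> \<phi> \<longleftrightarrow> sem_closed M \<phi> (init_state M) = 1"


section \<open>The encoding of automata\<close>

datatype 'c ap = Letter 'c | Final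

fun automaton_trans ::
  "('q, 'c::finite) prob_automaton \<Rightarrow> 'q + 'q \<times> 'c \<Rightarrow> ('q + 'q \<times> 'c) pmf" where
  "automaton_trans A (Inl q) = map_pmf (\<lambda>c. Inr (q, c)) (pmf_of_set UNIV)"
| "automaton_trans A (Inr (q, c)) = map_pmf Inl (delta A q c)"

fun automaton_labelling ::
  "('q, 'c) prob_automaton \<Rightarrow> 'c ap \<Rightarrow> ('q + 'q \<times> 'c) set" where
  "automaton_labelling A (Letter c) = {Inr (q, c) | q. True}"
| "automaton_labelling A Final = Inl ` final A"

definition automaton_chain ::
  "('q, 'c::finite) prob_automaton \<Rightarrow> ('q + 'q \<times> 'c, 'c ap) markov_chain" where
  "automaton_chain A =
     \<lparr>trans_prob = automaton_trans A, labelling = automaton_labelling A,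
      init_state = Inl (initial A)\<rparr>"

lemma pmf_automaton_trans:
  fixes A :: "('q, 'c::finite) prob_automaton"
  shows "pmf (automaton_trans A (Inl q)) (Inr (q', c)) = (if q' = q then 1 / CARD('c) else 0)"
    and "pmf (automaton_trans A (Inl q)) (Inl q') = 0"
    and "pmf (automaton_trans A (Inr (q, c))) (Inl q') = pmf (delta A q c) q'"
    and "pmf (automaton_trans A (Inr (q, c))) (Inr (q', c')) = 0"
proof -
  have inj: "inj (\<lambda>c::'c. Inr (q, c) :: 'q + 'q \<times> 'c)"
    by (auto simp: inj_on_def)
  show "pmf (automaton_trans A (Inl q)) (Inr (q', c)) = (if q' = q then 1 / CARD('c) else 0)"
    using pmf_map_inj'[OF inj, of "pmf_of_set UNIV" c]
    by (auto simp: pmf_eq_0_set_pmf)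
  show "pmf (automaton_trans A (Inl q)) (Inl q') = 0"
    by (auto simp: pmf_eq_0_set_pmf)
  show "pmf (automaton_trans A (Inr (q, c))) (Inl q') = pmf (delta A q c) q'"
    by (simp add: pmf_map_inj')
  show "pmf (automaton_trans A (Inr (q, c))) (Inr (q', c')) = 0"
    by (auto simp: pmf_eq_0_set_pmf)
qed

definition letter_step :: "'c \<Rightarrow> 'c ap fun_formula" where
  "letter_step c = Lam 0 (Diamond (And (Atom (Letter c)) (Next (PVar 0))))"

definition theta :: "'c::finite ap fun_formula" where
  "theta = FMu 0 (Lam 0 (Or (PVar 0)
     (FDisj (fimage (\<lambda>c. App (FVar 0) (App (letter_step c) (PVar 0))) fUNIV))))"

end

theory Submission
  imports Defs
begin

text \<open>Unfolding the fixpoint equation \<open>F X = X \<or> \<Or>\<^sub>c F (f\<^sub>c X)\<close> shows that its least solution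
  maps \<open>v\<close> to the supremum over all words \<open>c\<^sub>1 \<dots> c\<^sub>n\<close> of \<open>f\<^bsub>c\<^sub>1\<^esub> (\<dots> (f\<^bsub>c\<^sub>n\<^esub> v))\<close>. At an automaton
  state \<open>q\<close> the modality \<open>\<Diamond>\<close> in \<open>f\<^sub>c\<close> selects the successor \<open>(q, c)\<close>, so that \<open>f\<^sub>c v\<close> is the
  expectation of \<open>v\<close> after reading \<open>c\<close>; iterating along a word gives its acceptance probability.\<close>

lemma unit_interval_nonneg [simp]: "0 \<le> (x :: unit_interval)"
  by transfer simp

lemma unit_interval_le_one [simp]: "(x :: unit_interval) \<le> 1"
  by transfer simp

lemma unit_interval_zero_neq_one [simp]: "(0 :: unit_interval) \<noteq> 1"
  by transfer simp

text \<open>The index is a whole type, so the family is nonempty and its real supremum stays in the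
  unit interval.\<close>

lift_definition unit_SUP :: "('i \<Rightarrow> unit_interval) \<Rightarrow> unit_interval"
  is "\<lambda>f. SUP i. f i"
proof -
  fix f :: "'i \<Rightarrow> real"
  assume f: "\<And>i. f i \<in> {0..1}"
  then have "bdd_above (range f)"
    by (auto intro!: bdd_aboveI[of _ 1])
  then have "f undefined \<le> (SUP i. f i)"
    by (rule cSUP_upper[OF UNIV_I])
  moreover have "(SUP i. f i) \<le> 1"
    using f by (intro cSUP_least) auto
  ultimately show "(SUP i. f i) \<in> {0..1}"
    using f[of undefined] by auto
qed

lemma unit_SUP_upper: "f i \<le> unit_SUP f"
  by transfer (auto intro!: cSUP_upper bdd_aboveI[of _ 1])

lemma unit_SUP_least: "(\<And>i. f i \<le> x) \<Longrightarrow> unit_SUP f \<le> x"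
  by transfer (auto intro!: cSUP_least)

lemma foldr_mono:
  fixes f :: "'c \<Rightarrow> 'v::order \<Rightarrow> 'v"
  assumes "\<And>c. mono (f c)"
  shows "mono (foldr f w)"
  by (induction w) (auto simp: mono_def intro: monoD[OF assms])

text \<open>Each unfolding of the equation replaces \<open>v\<close> by \<open>f c v\<close>, which
  appends \<open>c\<close> on the right of a word, as
  \<open>foldr f (w @ [c]) v = foldr f w (f c v)\<close>. Monotonicity of each \<open>f c\<close>
  makes the word supremum a candidate for \<open>LEAST\<close>. Leastness needs no continuity: every
  single finite word is already bounded by any fixpoint. The \<open>insert 0\<close> is the shape
  that \<open>FDisj\<close> produces.\<close>

lemma Least_word_fixpoint:
  fixes f :: "'c::finite \<Rightarrow> 's prop_val \<Rightarrow> 's prop_val"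
  assumes f: "\<And>c. mono (f c)"
  shows "(LEAST g. mono g \<and> (\<lambda>v s. max (v s) (Max (insert 0 (range (\<lambda>c. g (f c v) s))))) = g) =
    (\<lambda>v s. unit_SUP (\<lambda>w. foldr f w v s))"
    (is "(LEAST g. mono g \<and> ?\<Phi> g = g) = ?G")
proof (rule Least_equality)
  have "mono ?G"
  proof (intro monoI le_funI unit_SUP_least)
    fix u v :: "'s prop_val" and s w
    assume "u \<le> v"
    then have "foldr f w u s \<le> foldr f w v s"
      using foldr_mono[of f w, OF f] by (auto dest: monoD le_funD)
    also have "\<dots> \<le> ?G v s"
      by (rule unit_SUP_upper)
    finally show "foldr f w u s \<le> ?G v s" .
  qed
  moreover have "?\<Phi> ?G = ?G"
  proof (intro ext antisym)
    fix v s
    have "v s \<le> ?G v s"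
      using unit_SUP_upper[of "\<lambda>w. foldr f w v s" "[]"] by simp
    moreover have "?G (f c v) s \<le> ?G v s" for c
    proof (rule unit_SUP_least)
      fix w
      show "foldr f w (f c v) s \<le> ?G v s"
        using unit_SUP_upper[of "\<lambda>w. foldr f w v s" "w @ [c]"] by simp
    qed
    ultimately show "?\<Phi> ?G v s \<le> ?G v s"
      by auto
    show "?G v s \<le> ?\<Phi> ?G v s"
    proof (rule unit_SUP_least)
      fix w
      show "foldr f w v s \<le> ?\<Phi> ?G v s"
      proof (cases w rule: rev_cases)
        case Nil
        then show ?thesis by simp
      next
        case (snoc w' c)
        then have "foldr f w v s \<le> ?G (f c v) s"
          using unit_SUP_upper[of "\<lambda>w. foldr f w (f c v) s" w'] by simp
        also have "\<dots> \<le> Max (insert 0 (range (\<lambda>c. ?G (f c v) s)))"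
          by (rule Max_ge) auto
        also have "\<dots> \<le> ?\<Phi> ?G v s"
          by (rule max.cobounded2)
        finally show ?thesis .
      qed
    qed
  qed
  ultimately show "mono ?G \<and> ?\<Phi> ?G = ?G" ..
next
  fix g
  assume "mono g \<and> ?\<Phi> g = g"
  then have "?\<Phi> g = g" ..
  then have g: "g v s = ?\<Phi> g v s" for v s
    by (rule fun_cong[OF fun_cong, symmetric])
  \<comment> \<open>\<open>v\<close> has to vary, since the induction hypothesis is used at
    \<open>f c v\<close>.\<close>
  have "foldr f w v s \<le> g v s" for w v s
  proof (induction w arbitrary: v rule: rev_induct)
    case Nil
    show ?case by (subst g) simp
  next
    case (snoc c w)
    have "foldr f (w @ [c]) v s \<le> g (f c v) s"
      using snoc by simp
    also have "\<dots> \<le> Max (insert 0 (range (\<lambda>c. g (f c v) s)))"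
      by (rule Max_ge) auto
    also have "\<dots> \<le> g v s"
      by (subst (2) g) (rule max.cobounded2)
    finally show ?case .
  qed
  then show "?G \<le> g"
    by (intro le_funI unit_SUP_least)
qed

text \<open>The value on \<open>Inr\<close> is 0 because such states move only to automaton states,
  which carry no letter label.\<close>

definition letter_sem ::
  "('q::finite, 'c::finite) prob_automaton \<Rightarrow> 'c \<Rightarrow> ('q + 'q \<times> 'c) fun_val" where
  "letter_sem A c v s = (case s of Inl q \<Rightarrow> expect (delta A q c) (v \<circ> Inl) | Inr _ \<Rightarrow> 0)"

lemma expect_mono: "u \<le> v \<Longrightarrow> expect p u \<le> expect p v"
  unfolding le_fun_def by transfer (auto intro!: sum_mono mult_left_mono)

lemma mono_letter_sem: "mono (letter_sem A c)"
  by (auto simp: letter_sem_def le_fun_def split: sum.split intro!: monoI expect_mono)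

lemma expect_automaton_trans_Inr:
  "expect (automaton_trans A (Inr (q, c))) v = expect (delta A q c) (v \<circ> Inl)"
proof -
  have "(\<Sum>s\<in>UNIV. pmf (automaton_trans A (Inr (q, c))) s * Rep_unit_interval (v s)) =
      (\<Sum>s\<in>range Inl. pmf (automaton_trans A (Inr (q, c))) s * Rep_unit_interval (v s))"
  proof (rule sum.mono_neutral_right)
    show "\<forall>s\<in>UNIV - range Inl. pmf (automaton_trans A (Inr (q, c))) s * Rep_unit_interval (v s) = 0"
      by (auto simp: pmf_eq_0_set_pmf)
  qed auto
  also have "\<dots> = (\<Sum>q'\<in>UNIV. pmf (delta A q c) q' * Rep_unit_interval (v (Inl q')))"
    by (simp add: sum.reindex pmf_automaton_trans del: automaton_trans.simps)
  finally show ?thesis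
    by (simp add: Rep_unit_interval_inject[symmetric] expect.rep_eq del: automaton_trans.simps)
qed

text \<open>Every \<open>Inr (q, d)\<close> is a successor of \<open>Inl q\<close> because the
  letter is drawn uniformly. The label cuts the value down to 0 unless \<open>d = c\<close>, so the
  maximum is the value at \<open>Inr (q, c)\<close>.\<close>

lemma sem_fun_letter_step:
  fixes A :: "('q::finite, 'c::finite) prob_automaton"
  shows "sem_fun (automaton_chain A) (letter_step c) \<rho> \<eta> = letter_sem A c"
proof (intro ext)
  fix v and s :: "'q + 'q \<times> 'c"
  let ?h = "\<lambda>s'. min (if s' \<in> automaton_labelling A (Letter c) then 1 else 0)
    (expect (automaton_trans A s') v)"
  have sem: "sem_fun (automaton_chain A) (letter_step c) \<rho> \<eta> v s =
      Max (?h ` set_pmf (automaton_trans A s))"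
    by (simp add: letter_step_def automaton_chain_def image_def Bex_def conj_commute
        pmf_positive_iff)
  show "sem_fun (automaton_chain A) (letter_step c) \<rho> \<eta> v s = letter_sem A c v s"
  proof (cases s)
    case (Inl q)
    have "Max (range (\<lambda>d. ?h (Inr (q, d)))) = expect (delta A q c) (v \<circ> Inl)"
    proof (rule Max_eqI)
      show "expect (delta A q c) (v \<circ> Inl) \<in> range (\<lambda>d. ?h (Inr (q, d)))"
        by (rule range_eqI[of _ _ c]) (simp add: expect_automaton_trans_Inr del: automaton_trans.simps)
    qed (auto simp: expect_automaton_trans_Inr simp del: automaton_trans.simps split: if_splits)
    moreover have "set_pmf (automaton_trans A (Inl q)) = range (\<lambda>d. Inr (q, d))"
      by simp
    ultimately show ?thesis
      by (simp only: sem[unfolded Inl] Inl letter_sem_def image_image sum.case)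
  next
    case (Inr x)
    obtain q d where x: "x = (q, d)" by force
    \<comment> \<open>No successor is labelled with a letter, and the support is nonempty, so the
      image is not empty either.\<close>
    have "?h ` set_pmf (automaton_trans A s) = {0}"
      using set_pmf_not_empty[of "delta A q d"] by (auto simp: Inr x image_image)
    then show ?thesis
      unfolding sem by (simp add: Inr letter_sem_def)
  qed
qed

lemma sem_fun_theta:
  fixes A :: "('q::finite, 'c::finite) prob_automaton"
  shows "sem_fun (automaton_chain A) theta \<rho> \<eta> v s =
    unit_SUP (\<lambda>w. foldr (letter_sem A) w v s)"
  using fun_cong[OF fun_cong[OF Least_word_fixpoint[of "letter_sem A", OF mono_letter_sem]], of v s]
  by (simp add: theta_def sem_fun_letter_step image_image)

text \<open>Unlike in \<open>accepting_runs\<close>, the start state is free and the end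
  unconstrained, so that induction on the word can move the start.\<close>

definition runs_from :: "'q \<Rightarrow> nat \<Rightarrow> 'q list set" where
  "runs_from q n = {r. length r = Suc n \<and> r ! 0 = q}"

lemma finite_runs_from [simp]: "finite (runs_from (q::'q::finite) n)"
  using finite_lists_length_eq[of "UNIV :: 'q set" "Suc n"]
  by (rule finite_subset[rotated]) (auto simp: runs_from_def)

lemma runs_from_0: "runs_from q 0 = {[q]}"
  by (auto simp: runs_from_def length_Suc_conv)

lemma runs_from_Suc: "runs_from q (Suc n) = (\<Union>q'. (#) q ` runs_from q' n)"
  by (auto simp: runs_from_def length_Suc_conv image_iff)

text \<open>This is the expected payoff \<open>v\<close> at the end of a run. Here the first letter
  is peeled off, being the outermost application in \<open>foldr\<close>, and the runs are split by
  their second state.\<close>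

lemma foldr_letter_sem:
  "Rep_unit_interval (foldr (letter_sem A) w v (Inl q)) =
    (\<Sum>r\<in>runs_from q (length w). (\<Prod>i<length w. pmf (delta A (r ! i) (w ! i)) (r ! Suc i)) *
      Rep_unit_interval (v (Inl (r ! length w))))"
proof (induction w arbitrary: q)
  case Nil
  show ?case by (simp add: runs_from_0)
next
  case (Cons c w)
  let ?W = "\<lambda>w r. (\<Prod>i<length w. pmf (delta A (r ! i) (w ! i)) (r ! Suc i)) *
    Rep_unit_interval (v (Inl (r ! length w)))"
  have "(\<Sum>r\<in>runs_from q (length (c # w)). ?W (c # w) r) =
      (\<Sum>q'\<in>UNIV. \<Sum>r\<in>(#) q ` runs_from q' (length w). ?W (c # w) r)"
    unfolding length_Cons runs_from_Suc
    \<comment> \<open>The pieces are disjoint because \<open>q'\<close> is the second entry of each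
      run in its piece.\<close>
    by (rule sum.UNION_disjoint) (auto, auto simp: runs_from_def)
  also have "\<dots> = (\<Sum>q'\<in>UNIV. pmf (delta A q c) q' * (\<Sum>r\<in>runs_from q' (length w). ?W w r))"
  proof (rule sum.cong[OF refl])
    fix q'
    have "(\<Sum>r\<in>(#) q ` runs_from q' (length w). ?W (c # w) r) =
        (\<Sum>r\<in>runs_from q' (length w). ?W (c # w) (q # r))"
      by (subst sum.reindex) (simp_all only: inj_on_Cons1 o_def)
    also have "\<dots> = (\<Sum>r\<in>runs_from q' (length w). pmf (delta A q c) q' * ?W w r)"
      by (rule sum.cong[OF refl])
        (simp add: prod.lessThan_Suc_shift runs_from_def del: prod.lessThan_Suc)
    finally show "(\<Sum>r\<in>(#) q ` runs_from q' (length w). ?W (c # w) r) =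
        pmf (delta A q c) q' * (\<Sum>r\<in>runs_from q' (length w). ?W w r)"
      by (simp only: sum_distrib_left)
  qed
  finally show ?case
    by (simp add: letter_sem_def[of A c _ "Inl q"] expect.rep_eq Cons.IH del: list.size)
qed

text \<open>With the indicator of the final states as payoff, the runs that are not accepting
  contribute 0.\<close>

lemma acc_prob_eq_foldr:
  "acc_prob A w = Rep_unit_interval
    (foldr (letter_sem A) w (\<lambda>s. if s \<in> Inl ` final A then 1 else 0) (Inl (initial A)))"
proof -
  have "accepting_runs A w = {r \<in> runs_from (initial A) (length w). r ! length w \<in> final A}"
    by (auto simp: accepting_runs_def runs_from_def)
  then show ?thesis
    unfolding acc_prob_def foldr_letter_sem
    by (auto simp: sum.inter_filter zero_unit_interval.rep_eq one_unit_interval.rep_eq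
        intro!: sum.cong)
qed

lemma val_eq_sem_theta:
  fixes A :: "('q::finite, 'c::finite) prob_automaton"
  shows "val A =
    Rep_unit_interval (sem_closed (automaton_chain A) (App theta (Atom Final)) (Inl (initial A)))"
proof -
  have "labelling (automaton_chain A) Final = Inl ` final A"
    by (simp add: automaton_chain_def)
  then show ?thesis
    unfolding val_def sem_closed_def
    by (simp add: sem_fun_theta unit_SUP.rep_eq acc_prob_eq_foldr)
qed

theorem theorem3p5:
  fixes A :: "('q::finite, 'c::finite) prob_automaton"
  shows "val A =
      Rep_unit_interval (sem_closed (automaton_chain A) (App theta (Atom Final)) (Inl (initial A))) \<and>
    (automaton_chain A \<Turnstile> GeOne (App theta (Atom Final)) \<longleftrightarrow> val A = 1)"
proof
  let ?x = "sem_closed (automaton_chain A) (App theta (Atom Final)) (Inl (initial A))"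
  show val: "val A = Rep_unit_interval ?x"
    by (rule val_eq_sem_theta)
  have "automaton_chain A \<Turnstile> GeOne (App theta (Atom Final)) \<longleftrightarrow> ?x \<ge> 1"
    by (simp add: models_def sem_closed_def automaton_chain_def)
  also have "\<dots> \<longleftrightarrow> ?x = 1"
    by (auto intro: antisym)
  also have "\<dots> \<longleftrightarrow> val A = 1"
    unfolding val by (metis Rep_unit_interval_inject one_unit_interval.rep_eq)
  finally show "automaton_chain A \<Turnstile> GeOne (App theta (Atom Final)) \<longleftrightarrow> val A = 1" .
qed

end
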